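(* Let $r_m>1$, $X=\{(x_1,x_2)\in\mathbb{R}^2 : 2-r_m<x_2<1\}$, $Y=(0,\infty)\times\mathbb{R}$, and for $j=1,2$ let $\mathcal{C}_j\subset T^*(Y)\times T^*(X)$ be the canonical relation of the circle transform $\mathcal{T}_j$ (given explicitly in the context). Let $\mathcal{C}=\mathcal{C}_1\cup\mathcal{C}_2$ (a disjoint union) be the canonical relation of the toric section transform $\mathcal{T}=\mathcal{T}_1+\mathcal{T}_2$, and let $\pi_R$ denote the natural projection to $T^*(X)$. Then for $j=1,2$ the projection $\pi_R:\mathcal{C}_j\to T^*(X)$ is bijective onto the set $$D=\{(\mathbf{x},\boldsymbol{\xi})\in T^*(X) : \xi_2\neq 0\}.$$ In addition, $\pi_R:\mathcal{C}\to T^*(X)$ is two-to-one onto $D$ (its image is $D$ and every point of $D$ has exactly two preimages in $\mathcal{C}$).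
   Context: Cotangent bundles are identified with products: $T^*(X)=X\times\mathbb{R}^2$, and elements are written $(\mathbf{x},\boldsymbol{\xi})$ with $\mathbf{x}=(x_1,x_2)$, $\boldsymbol{\xi}=(\xi_1,\xi_2)$; elements of $T^*(Y)=Y\times\mathbb{R}^2$ are written $(s,x_0,\tau_1,\tau_2)$. For $j=1,2$ and $(s,x_0)\in Y$ let $\mathbf{c}_j(s,x_0)=((-1)^js+x_0,\,2)$ and let $C_j(s,x_0)=\{\mathbf{x}\in\mathbb{R}^2 : |\mathbf{x}-\mathbf{c}_j(s,x_0)|^2=s^2+1\}$ be the circle with center $\mathbf{c}_j(s,x_0)$ and radius $\sqrt{s^2+1}$. The circle transforms are $\mathcal{T}_jf(s,x_0)=\int_{C_j(s,x_0)}f\,\mathrm{d}l$ (arc length measure) and the toric section transform is $\mathcal{T}f=\mathcal{T}_1f+\mathcal{T}_2f$. The canonical relation of $\mathcal{T}_j$ is $$ \begin{aligned} \mathcal{C}_j=\Big\{\big(&(s,x_0,(-1)^{j-1}\sigma(x_1-x_0),-\sigma((-1)^{j-1}s+x_1-x_0))\,;\,(\mathbf{x},-\sigma(\mathbf{x}-\mathbf{c}_j(s,x_0)))\big) :\\ &(s,x_0)\in Y,\ \sigma\in\mathbb{R}\setminus\{0\},\ \mathbf{x}=(x_1,x_2)\in C_j(s,x_0)\cap X\Big\}. \end{aligned} $$ The projection $\pi_R$ sends $((s,x_0,\tau_1,\tau_2);(\mathbf{x},\boldsymbol{\xi}))$ to $(\mathbf{x},\boldsymbol{\xi})$. *)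

theory Defs
  imports "HOL-Analysis.Analysis"
begin

text \<open>The plane is \<^typ>\<open>real \<times> real\<close>, whose library norm is the Euclidean one. Covectors are
  kept separate from base points, so an element of the cotangent bundle of the data space
  has the form \<open>((s, x0), (tau1, tau2))\<close>.\<close>

type_synonym plane = "real \<times> real"

definition cotangent :: "plane set \<Rightarrow> (plane \<times> plane) set" where
  "cotangent U = U \<times> UNIV"

definition X_dom :: "real \<Rightarrow> plane set" where
  "X_dom r_m = {(x1, x2). 2 - r_m < x2 \<and> x2 < 1}"

definition Y_dom :: "plane set" where
  "Y_dom = {0<..} \<times> UNIV"

definition center :: "nat \<Rightarrow> real \<Rightarrow> real \<Rightarrow> plane" where
  "center j s x0 = ((-1) ^ j * s + x0, 2)"

definition circle :: "nat \<Rightarrow> real \<Rightarrow> real \<Rightarrow> plane set" where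
  "circle j s x0 = {x. (norm (x - center j s x0))\<^sup>2 = s\<^sup>2 + 1}"

text \<open>Only the indices \<open>j = 1\<close> and \<open>j = 2\<close> are meaningful (so \<open>j - 1\<close> does not truncate).\<close>

definition canonical_relation :: "real \<Rightarrow> nat \<Rightarrow> ((plane \<times> plane) \<times> (plane \<times> plane)) set" where
  "canonical_relation r_m j =
     {(((s, x0), ((-1) ^ (j - 1) * \<sigma> * (x1 - x0), - \<sigma> * ((-1) ^ (j - 1) * s + x1 - x0))),
       ((x1, x2), - \<sigma> *\<^sub>R ((x1, x2) - center j s x0))) | s x0 \<sigma> x1 x2.
      (s, x0) \<in> Y_dom \<and> \<sigma> \<noteq> 0 \<and> (x1, x2) \<in> circle j s x0 \<inter> X_dom r_m}"

lemma canonical_relation_subset: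
  "canonical_relation r_m j \<subseteq> cotangent Y_dom \<times> cotangent (X_dom r_m)"
  by (auto simp: canonical_relation_def cotangent_def)

definition toric_canonical_relation :: "real \<Rightarrow> ((plane \<times> plane) \<times> (plane \<times> plane)) set" where
  "toric_canonical_relation r_m = canonical_relation r_m 1 \<union> canonical_relation r_m 2"

definition pi_R :: "(plane \<times> plane) \<times> (plane \<times> plane) \<Rightarrow> plane \<times> plane" where
  "pi_R = snd"

definition D_set :: "real \<Rightarrow> (plane \<times> plane) set" where
  "D_set r_m = {(x, (\<xi>1, \<xi>2)) \<in> cotangent (X_dom r_m). \<xi>2 \<noteq> 0}"

end

theory Submission
  imports Defs
begin

text \<open>A covector \<open>\<xi> = - \<sigma> (x - c)\<close> at \<open>x\<close> is conormal to a circle whose centre \<open>c\<close> lies on the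
  line of height 2. Comparing second coordinates gives \<open>\<sigma> = \<xi>2 / (2 - x2)\<close>, then the first
  coordinates give \<open>u = x1 - c1 = - \<xi>1 / \<sigma>\<close>, the circle equation forces \<open>s\<^sup>2 = u\<^sup>2 + (2 - x2)\<^sup>2 - 1\<close>,
  which is positive because \<open>x2 < 1\<close>, and \<open>x0\<close> is determined by \<open>c1\<close> and \<open>s\<close>. So each of the two
  projections has an explicit inverse on \<open>\<xi>2 \<noteq> 0\<close>. The two preimages of a covector
  differ since the data covectors \<open>\<tau>2\<close> differ by \<open>2 \<sigma> s\<close> when \<open>(s, x0)\<close> is the same.\<close>

text \<open>The covector part is returned as \<open>q\<close> itself, not recomputed from \<sigma>
  and the centre, so that \<open>pi_R\<close> undoes the lift for every \<open>q\<close>, even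
  outside \<open>D_set\<close>.\<close>

definition lift_conormal ::
    "nat \<Rightarrow> plane \<times> plane \<Rightarrow> (plane \<times> plane) \<times> (plane \<times> plane)" where
  "lift_conormal j q = (case q of ((x1, x2), (\<xi>1, \<xi>2)) \<Rightarrow>
     let \<sigma> = \<xi>2 / (2 - x2); u = - \<xi>1 / \<sigma>;
       s = sqrt (u\<^sup>2 + (2 - x2)\<^sup>2 - 1); x0 = x1 - u - (-1) ^ j * s
     in (((s, x0), ((-1) ^ (j - 1) * \<sigma> * (x1 - x0), - \<sigma> * ((-1) ^ (j - 1) * s + x1 - x0))), q))"

lemma pi_R_lift_conormal [simp]: "pi_R (lift_conormal j q) = q"
  by (auto simp: lift_conormal_def pi_R_def Let_def split: prod.splits)

lemma mem_circle_iff: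
  "(x1, x2) \<in> circle j s x0 \<longleftrightarrow> (x1 - ((-1) ^ j * s + x0))\<^sup>2 + (2 - x2)\<^sup>2 = s\<^sup>2 + 1"
  by (simp add: circle_def center_def norm_Pair power2_commute[of x2 2])

lemma canonical_relation_lift:
  assumes "p \<in> canonical_relation r_m j"
  shows "pi_R p \<in> D_set r_m" and "p = lift_conormal j (pi_R p)"
proof -
  obtain s x0 \<sigma> x1 x2 where
    p: "p = (((s, x0), ((-1) ^ (j - 1) * \<sigma> * (x1 - x0), - \<sigma> * ((-1) ^ (j - 1) * s + x1 - x0))),
       ((x1, x2), - \<sigma> *\<^sub>R ((x1, x2) - center j s x0)))"
    and Y: "(s, x0) \<in> Y_dom" and \<sigma>: "\<sigma> \<noteq> 0"
    and circ: "(x1, x2) \<in> circle j s x0" and X: "(x1, x2) \<in> X_dom r_m"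
    using assms unfolding canonical_relation_def by blast
  have s: "s > 0" using Y by (simp add: Y_dom_def)
  define u where "u = x1 - ((-1) ^ j * s + x0)"
  have \<xi>: "- \<sigma> *\<^sub>R ((x1, x2) - center j s x0) = (- \<sigma> * u, \<sigma> * (2 - x2))"
    by (simp add: center_def u_def algebra_simps)
  have x2: "2 - x2 > 0" using X by (simp add: X_dom_def)
  show "pi_R p \<in> D_set r_m"
    using X \<sigma> x2 unfolding p \<xi> by (simp add: pi_R_def D_set_def cotangent_def)
  \<comment> \<open>These four equations have the shape in which unfolding
    \<open>lift_conormal\<close> at the covector (-\<sigma> u, \<sigma> (2 - x2)) produces its
    terms. Here s > 0 selects the positive root.\<close>
  have s_eq: "sqrt (u\<^sup>2 + (2 - x2)\<^sup>2 - 1) = s"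
    using circ s unfolding mem_circle_iff u_def[symmetric] by simp
  have \<sigma>_eq: "\<sigma> * (2 - x2) / (2 - x2) = \<sigma>" using x2 by simp
  have u_eq: "- (- \<sigma> * u) / \<sigma> = u" using \<sigma> by simp
  have x0_eq: "x1 - u - (-1) ^ j * s = x0" by (simp add: u_def)
  show "p = lift_conormal j (pi_R p)"
    unfolding p \<xi> pi_R_def snd_conv lift_conormal_def Let_def prod.case \<sigma>_eq u_eq s_eq x0_eq ..
qed

lemma lift_conormal_mem:
  assumes "q \<in> D_set r_m"
  shows "lift_conormal j q \<in> canonical_relation r_m j"
proof -
  obtain x1 x2 \<xi>1 \<xi>2 where q: "q = ((x1, x2), (\<xi>1, \<xi>2))"
    and X: "(x1, x2) \<in> X_dom r_m" and \<xi>2: "\<xi>2 \<noteq> 0"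
    using assms by (auto simp: D_set_def cotangent_def)
  have x2: "2 - x2 > 1" using X by (simp add: X_dom_def)
  define \<sigma> where "\<sigma> = \<xi>2 / (2 - x2)"
  define u where "u = - \<xi>1 / \<sigma>"
  define s where "s = sqrt (u\<^sup>2 + (2 - x2)\<^sup>2 - 1)"
  define x0 where "x0 = x1 - u - (-1) ^ j * s"
  have \<sigma>: "\<sigma> \<noteq> 0" using \<xi>2 x2 by (simp add: \<sigma>_def)
  \<comment> \<open>As x2 < 1, any point at height 2 is more than 1 away, so the radius forces s to
    be nonzero.\<close>
  have pos: "u\<^sup>2 + (2 - x2)\<^sup>2 - 1 > 0"
    using one_less_power[OF x2, of 2] zero_le_power2[of u] by linarith
  then have s: "s > 0" "s\<^sup>2 = u\<^sup>2 + (2 - x2)\<^sup>2 - 1"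
    by (simp_all add: s_def)
  have circ: "(x1, x2) \<in> circle j s x0"
    by (simp add: mem_circle_iff x0_def s(2))
  have "\<xi>1 = - \<sigma> * u" "\<xi>2 = \<sigma> * (2 - x2)"
    using \<sigma> x2 by (simp_all add: u_def \<sigma>_def)
  then have \<xi>: "(\<xi>1, \<xi>2) = - \<sigma> *\<^sub>R ((x1, x2) - center j s x0)"
    by (simp add: center_def x0_def algebra_simps)
  have "lift_conormal j q =
    (((s, x0), ((-1) ^ (j - 1) * \<sigma> * (x1 - x0), - \<sigma> * ((-1) ^ (j - 1) * s + x1 - x0))),
       ((x1, x2), (\<xi>1, \<xi>2)))"
    unfolding q lift_conormal_def Let_def prod.case x0_def s_def u_def \<sigma>_def ..
  then show ?thesis
    using s(1) \<sigma> circ X unfolding \<xi> canonical_relation_def Y_dom_def by auto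
qed

text \<open>Each relation is thus the graph of its lift over \<open>D_set\<close>, which makes
  bijectivity and the description of fibres formal.\<close>

lemma canonical_relation_iff:
  "p \<in> canonical_relation r_m j \<longleftrightarrow> pi_R p \<in> D_set r_m \<and> p = lift_conormal j (pi_R p)"
  by (metis canonical_relation_lift lift_conormal_mem)

lemma bij_betw_pi_R: "bij_betw pi_R (canonical_relation r_m j) (D_set r_m)"
  by (rule bij_betw_byWitness[where f' = "lift_conormal j"])
    (auto simp: canonical_relation_iff)

text \<open>For a common element, \<xi>2 forces equal \<sigma>, and then \<xi>1 forces equal centres
  x0 - s and x0 + s, against s > 0.\<close>

lemma canonical_relations_disjoint: "canonical_relation r_m 1 \<inter> canonical_relation r_m 2 = {}"
  by (auto simp: canonical_relation_def X_dom_def Y_dom_def center_def)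

theorem theorem3p2:
  fixes r_m :: real
  assumes "r_m > 1"
  shows "(\<forall>j\<in>{1, 2}. bij_betw pi_R (canonical_relation r_m j) (D_set r_m)) \<and>
    canonical_relation r_m 1 \<inter> canonical_relation r_m 2 = {} \<and>
    pi_R ` toric_canonical_relation r_m = D_set r_m \<and>
    (\<forall>q\<in>D_set r_m. card {p \<in> toric_canonical_relation r_m. pi_R p = q} = 2)"
proof (intro conjI ballI)
  show "bij_betw pi_R (canonical_relation r_m j) (D_set r_m)" for j
    by (rule bij_betw_pi_R)
  show "canonical_relation r_m 1 \<inter> canonical_relation r_m 2 = {}"
    by (rule canonical_relations_disjoint)
  show "pi_R ` toric_canonical_relation r_m = D_set r_m"
    by (simp add: toric_canonical_relation_def image_Un bij_betw_imp_surj_on[OF bij_betw_pi_R])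
  fix q assume q: "q \<in> D_set r_m"
  have "{p \<in> toric_canonical_relation r_m. pi_R p = q} = {lift_conormal 1 q, lift_conormal 2 q}"
    using q by (auto simp: toric_canonical_relation_def canonical_relation_iff)
  moreover have "lift_conormal 1 q \<noteq> lift_conormal 2 q"
    using canonical_relations_disjoint[of r_m] lift_conormal_mem[OF q, of 1]
      lift_conormal_mem[OF q, of 2] by auto
  ultimately show "card {p \<in> toric_canonical_relation r_m. pi_R p = q} = 2"
    by simp
qed

end
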